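(* Let $d$ be a degree sequence with a balanced partition $(a,b)\in\mathrm{BP}(d)$, where $a=(a_1,\dots,a_p)$ and $b=(b_1,\dots,b_q)$ are non-increasing, and let $t$ be a positive integer. Then $(a,b)$ is $t$-tot-bigraphic if and only if, for all $\ell=1,\dots,p$, $$\sum_{i=1}^{\ell} a_i \le \sum_{i=1}^{q}\min\{\ell,b_i\}+t.$$
   Context: A degree sequence is a non-increasing sequence of positive integers with even sum. $\mathrm{BP}(d)$ is the set of pairs $(a,b)$ of complementary subsequences of $d$ (together forming $d$) with equal sums. Multigraphs are loopless (parallel edges allowed). For a multigraph $H=(V,E)$, $\mathrm{TotMult}(H)=|E|-|E'|$ where $E'$ is the edge set of the underlying simple graph (one copy per adjacent pair). The partition $(a,b)$ is $t$-tot-bigraphic if there exists a loopless multigraph $H$ whose underlying graph is bipartite with sides $A,B$, such that the degree sequence of $A$ is $a$, that of $B$ is $b$, and $\mathrm{TotMult}(H)\le t$. *)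

theory Defs
  imports Main "HOL-Library.Multiset"
begin

definition degree_sequence :: "nat list \<Rightarrow> bool" where
  "degree_sequence d \<longleftrightarrow> sorted_wrt (\<ge>) d \<and> (\<forall>x\<in>set d. 0 < x) \<and> even (sum_list d)"

text \<open>Complementary subsequences are the restrictions of \<open>d\<close> to a set of positions and to its
  complement; they inherit the non-increasing order of \<open>d\<close>.\<close>

definition BP :: "nat list \<Rightarrow> (nat list \<times> nat list) set" where
  "BP d = {(nths d I, nths d (- I)) | I. sum_list (nths d I) = sum_list (nths d (- I))}"

lemma sorted_wrt_nths:
  assumes "sorted_wrt R xs"
  shows "sorted_wrt R (nths xs I)"
  using assms by (induction xs arbitrary: I) (auto simp: nths_Cons dest: in_set_nthsD)

lemma BP_non_increasing:
  assumes "degree_sequence d" and "(a, b) \<in> BP d"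
  shows "sorted_wrt (\<ge>) a" and "sorted_wrt (\<ge>) b"
  using assms by (auto simp: BP_def degree_sequence_def intro: sorted_wrt_nths)

text \<open>An edge is its set of two ends; parallel edges are repeated elements of the multiset.\<close>

record 'v multigraph =
  verts :: "'v set"
  edges :: "'v set multiset"

definition loopless_multigraph :: "'v multigraph \<Rightarrow> bool" where
  "loopless_multigraph H \<longleftrightarrow>
     finite (verts H) \<and> (\<forall>e\<in>#edges H. e \<subseteq> verts H \<and> card e = 2)"

definition underlying_edges :: "'v multigraph \<Rightarrow> 'v set set" where
  "underlying_edges H = set_mset (edges H)"

definition TotMult :: "'v multigraph \<Rightarrow> nat" where
  "TotMult H = size (edges H) - card (underlying_edges H)"

definition degree :: "'v multigraph \<Rightarrow> 'v \<Rightarrow> nat" where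
  "degree H v = size {#e \<in># edges H. v \<in> e#}"

definition degree_sequence_of :: "'v multigraph \<Rightarrow> 'v set \<Rightarrow> nat list" where
  "degree_sequence_of H A = rev (sorted_list_of_multiset (image_mset (degree H) (mset_set A)))"

definition underlying_bipartite :: "'v multigraph \<Rightarrow> 'v set \<Rightarrow> 'v set \<Rightarrow> bool" where
  "underlying_bipartite H A B \<longleftrightarrow>
     A \<union> B = verts H \<and> A \<inter> B = {} \<and>
     (\<forall>e\<in>underlying_edges H. \<exists>u\<in>A. \<exists>v\<in>B. e = {u, v})"

text \<open>Multigraphs are finite, so taking natural numbers as vertices is no restriction.\<close>

definition tot_bigraphic :: "nat \<Rightarrow> nat list \<Rightarrow> nat list \<Rightarrow> bool" where
  "tot_bigraphic t a b \<longleftrightarrow>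
     (\<exists>(H :: nat multigraph) A B.
        loopless_multigraph H \<and> underlying_bipartite H A B \<and>
        degree_sequence_of H A = a \<and> degree_sequence_of H B = b \<and> TotMult H \<le> t)"

end

theory Submission
  imports Defs
begin

text \<open>Necessity: the edges at the first \<open>l\<close> vertices of \<open>A\<close> number at most the simple edges among them,
  of which a vertex \<open>w\<close> of \<open>B\<close> carries at most \<open>min l (degree w)\<close>, plus the total multiplicity.

  Sufficiency: it is enough to find a simple bipartite graph whose degrees do not exceed \<open>a\<close> and \<open>b\<close>
  and which misses at most \<open>t\<close> edges, since the remaining stubs on both sides can be paired
  arbitrarily. Such a graph is built greedily, as in the Gale--Ryser theorem: the vertex of largest
  degree \<open>a\<^sub>1\<close> is joined to the \<open>a\<^sub>1\<close> vertices of largest residual degree, or to all vertices of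
  positive residual degree if there are fewer; in the latter case the shortfall is charged to \<open>t\<close>.
  The family of inequalities is inherited by the residual problem.\<close>

section \<open>List sums and degree sequences\<close>

lemma sum_min_eq_sum_list: "(\<Sum>i<length b. min l (b ! i)) = sum_list (map (min l) (b :: nat list))"
  by (simp add: sum_list_sum_nth atLeast0LessThan)

lemma sum_nth_eq_sum_list_take:
  "l \<le> length a \<Longrightarrow> (\<Sum>i<l. a ! i) = sum_list (take l (a :: nat list))"
  by (simp add: sum_list_sum_nth atLeast0LessThan min_def)

text \<open>Turns entries of a degree sequence into degrees of actual vertices, so that a prefix of
  length \<open>l\<close> selects a set of \<open>l\<close> vertices.\<close>

lemma degree_sequence_of_eq_map:
  assumes "finite A"
  obtains vs where "distinct vs" "set vs = A" "degree_sequence_of H A = map (degree H) vs"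
proof -
  obtain xs where xs: "set xs = A" "distinct xs" using finite_distinct_list[OF assms] by blast
  let ?vs = "sort_key (degree H) xs"
  have "mset (map (degree H) ?vs) = image_mset (degree H) (mset_set A)"
    using mset_set_set[OF xs(2)] xs(1) by simp
  moreover have "sorted (map (degree H) ?vs)" by simp
  ultimately have "sorted_list_of_multiset (image_mset (degree H) (mset_set A)) = map (degree H) ?vs"
    by (metis sorted_list_of_multiset_mset sorted_sort_id)
  then have "degree_sequence_of H A = map (degree H) (rev ?vs)"
    by (simp add: degree_sequence_of_def rev_map)
  then show ?thesis using that[of "rev ?vs"] xs by simp
qed

section \<open>Necessity of the inequalities\<close>

lemma card_set_mset_le_size: "card (set_mset M) \<le> size M"
  by (induction M) (auto simp: card_insert_if)

text \<open>The excess of size over support is additive over \<open>P\<close> and its negation, and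
  both parts are nonnegative. For the edges of \<open>H\<close> the whole excess is
  \<open>TotMult H\<close>.\<close>

lemma size_filter_le_card_add_excess:
  "size (filter_mset P M) \<le> card {e \<in> set_mset M. P e} + (size M - card (set_mset M))"
proof -
  have "size M = size (filter_mset P M) + size (filter_mset (\<lambda>e. \<not> P e) M)"
    by (metis multiset_partition size_union)
  moreover have "card {e \<in> set_mset M. \<not> P e} \<le> size (filter_mset (\<lambda>e. \<not> P e) M)"
    using card_set_mset_le_size[of "filter_mset (\<lambda>e. \<not> P e) M"] by simp
  moreover have "card (set_mset M) = card {e \<in> set_mset M. P e} + card {e \<in> set_mset M. \<not> P e}"
    by (subst card_Un_disjoint[symmetric]) (auto intro: arg_cong[where f = card])
  ultimately show ?thesis by linarith
qed

text \<open>Double counting: an occurrence of \<open>e\<close> contributes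
  \<open>card (e \<inter> S)\<close> on the left, which is at most 1 and vanishes unless
  \<open>e\<close> meets \<open>S\<close>.\<close>

lemma sum_size_filter_le_size_filter_meet:
  assumes "finite S" "\<And>e. e \<in># M \<Longrightarrow> card (e \<inter> S) \<le> 1"
  shows "(\<Sum>v\<in>S. size {#e \<in># M. v \<in> e#}) \<le> size {#e \<in># M. e \<inter> S \<noteq> {}#}"
  using assms(2)
proof (induction M)
  case (add e M)
  have *: "size {#x \<in># add_mset e M. v \<in> x#} = of_bool (v \<in> e) + size {#x \<in># M. v \<in> x#}" for v
    by simp
  have "(\<Sum>v\<in>S. of_bool (v \<in> e)) = card (e \<inter> S)"
    using assms(1) by (simp add: Int_commute)
  then show ?case
    using add.IH add.prems[of e] add.prems unfolding * sum.distrib by fastforce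
qed simp

lemma sum_degree_le:
  assumes H: "loopless_multigraph H" "underlying_bipartite H A B" and S: "S \<subseteq> A"
  shows "(\<Sum>v\<in>S. degree H v) \<le> (\<Sum>w\<in>B. min (card S) (degree H w)) + TotMult H"
proof -
  have fin: "finite A" "finite B"
    using H by (auto simp: loopless_multigraph_def underlying_bipartite_def dest: finite_subset[rotated])
  then have finS: "finite S" using S finite_subset by blast
  have disj: "A \<inter> B = {}" and
    edge: "\<And>e. e \<in># edges H \<Longrightarrow> \<exists>u\<in>A. \<exists>v\<in>B. e = {u, v}"
    using H(2) by (auto simp: underlying_bipartite_def underlying_edges_def)
  have "card (e \<inter> S) \<le> 1" if "e \<in># edges H" for e
  proof -
    obtain u v where "u \<in> A" "v \<in> B" "e = {u, v}" using edge \<open>e \<in># edges H\<close> by blast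
    then have "e \<inter> S \<subseteq> {u}" using S disj by blast
    then show ?thesis using card_mono[of "{u}"] by fastforce
  qed
  then have "(\<Sum>v\<in>S. degree H v) \<le> size {#e \<in># edges H. e \<inter> S \<noteq> {}#}"
    unfolding degree_def by (rule sum_size_filter_le_size_filter_meet[OF finS])
  also have "\<dots> \<le> card {e \<in> set_mset (edges H). e \<inter> S \<noteq> {}} + TotMult H"
    unfolding TotMult_def underlying_edges_def by (rule size_filter_le_card_add_excess)
  \<comment> \<open>From here on only simple edges are counted, grouped by their end in
    \<open>B\<close>.\<close>
  also have "card {e \<in> set_mset (edges H). e \<inter> S \<noteq> {}}
      \<le> card (\<Union>w\<in>B. {e \<in> set_mset (edges H). w \<in> e \<and> e \<inter> S \<noteq> {}})"
  proof (rule card_mono)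
    show "finite (\<Union>w\<in>B. {e \<in> set_mset (edges H). w \<in> e \<and> e \<inter> S \<noteq> {}})" using fin by simp
    show "{e \<in> set_mset (edges H). e \<inter> S \<noteq> {}}
        \<subseteq> (\<Union>w\<in>B. {e \<in> set_mset (edges H). w \<in> e \<and> e \<inter> S \<noteq> {}})"
    proof
      fix e assume e: "e \<in> {e \<in> set_mset (edges H). e \<inter> S \<noteq> {}}"
      then obtain w where "w \<in> B" "w \<in> e" using edge[of e] by auto
      then show "e \<in> (\<Union>w\<in>B. {e \<in> set_mset (edges H). w \<in> e \<and> e \<inter> S \<noteq> {}})"
        using e by blast
    qed
  qed
  also have "\<dots> \<le> (\<Sum>w\<in>B. card {e \<in> set_mset (edges H). w \<in> e \<and> e \<inter> S \<noteq> {}})"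
    by (rule card_UN_le[OF fin(2)])
  also have "\<dots> \<le> (\<Sum>w\<in>B. min (card S) (degree H w))"
  proof (rule sum_mono)
    fix w assume w: "w \<in> B"
    let ?E = "{e \<in> set_mset (edges H). w \<in> e \<and> e \<inter> S \<noteq> {}}"
    \<comment> \<open>An edge at \<open>w\<close> that meets \<open>S\<close> is determined by its
      end in \<open>S\<close>, which gives the bound \<open>card S\<close>.\<close>
    have "?E \<subseteq> (\<lambda>u. {u, w}) ` S"
      using edge w S disj by fastforce
    then have "card ?E \<le> card S" by (rule surj_card_le[OF finS])
    moreover have "card ?E \<le> card (set_mset {#e \<in># edges H. w \<in> e#})"
      by (intro card_mono) auto
    then have "card ?E \<le> degree H w"
      unfolding degree_def using card_set_mset_le_size le_trans by blast
    ultimately show "card ?E \<le> min (card S) (degree H w)" by simp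
  qed
  finally show ?thesis by simp
qed

lemma tot_bigraphic_imp_sum_le:
  assumes "tot_bigraphic t a b" "l \<le> length a"
  shows "sum_list (take l a) \<le> sum_list (map (min l) b) + t"
proof -
  obtain H :: "nat multigraph" and A B where
    H: "loopless_multigraph H" "underlying_bipartite H A B" and
    ab: "degree_sequence_of H A = a" "degree_sequence_of H B = b" and t: "TotMult H \<le> t"
    using assms(1) by (auto simp: tot_bigraphic_def)
  have fin: "finite A" "finite B"
    using H by (auto simp: loopless_multigraph_def underlying_bipartite_def dest: finite_subset[rotated])
  obtain vs where vs: "distinct vs" "set vs = A" "a = map (degree H) vs"
    using degree_sequence_of_eq_map[OF fin(1), of H] ab(1) by metis
  obtain ws where ws: "distinct ws" "set ws = B" "b = map (degree H) ws"
    using degree_sequence_of_eq_map[OF fin(2), of H] ab(2) by metis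
  let ?S = "set (take l vs)"
  have "card ?S = l" using vs assms(2) by (simp add: distinct_card)
  moreover have "?S \<subseteq> A" using vs set_take_subset by fast
  moreover have "sum_list (take l a) = (\<Sum>v\<in>?S. degree H v)"
    using vs by (simp add: take_map sum_list_distinct_conv_sum_set)
  moreover have "sum_list (map (min l) b) = (\<Sum>w\<in>B. min l (degree H w))"
    using ws by (simp add: sum_list_distinct_conv_sum_set comp_def)
  ultimately show ?thesis using sum_degree_le[OF H, of ?S] t by simp
qed

section \<open>Greedy construction of a simple bipartite graph\<close>

lemma ex_subset_of_largest:
  fixes f :: "'a \<Rightarrow> nat"
  assumes "finite J" "k \<le> card J"
  shows "\<exists>C\<subseteq>J. card C = k \<and> (\<forall>x\<in>C. \<forall>y\<in>J - C. f y \<le> f x)"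
  using assms(2)
proof (induction k)
  case (Suc k)
  then obtain C where C: "C \<subseteq> J" "card C = k" "\<forall>x\<in>C. \<forall>y\<in>J - C. f y \<le> f x" by auto
  then have "f ` (J - C) \<noteq> {}" using Suc.prems by auto
  moreover have fin: "finite (f ` (J - C))" using assms(1) by simp
  ultimately have "Max (f ` (J - C)) \<in> f ` (J - C)" by (rule Max_in[rotated])
  then obtain z where z: "z \<in> J - C" "Max (f ` (J - C)) = f z" by (rule imageE) simp
  then have max: "f y \<le> f z" if "y \<in> J - C" for y
    using Max_ge[OF fin imageI[OF that]] by simp
  have "finite C" using C assms(1) finite_subset by blast
  then have "card (insert z C) = Suc k" using z C by simp
  moreover have "\<forall>x\<in>insert z C. \<forall>y\<in>J - insert z C. f y \<le> f x" using C(3) max by auto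
  ultimately show ?case using C(1) z(1) by (intro exI[of _ "insert z C"]) auto
qed (intro exI[of _ "{}"], simp)

text \<open>Entry by entry, \<open>a\<close> is dominated by \<open>x # a\<close>, its shift by one
  place.\<close>

lemma sum_list_take_le_take_Cons:
  fixes x :: nat
  assumes "sorted_wrt (\<ge>) (x # a)"
  shows "sum_list (take l a) \<le> sum_list (take l (x # a))"
  using assms
proof (induction a arbitrary: x l)
  case (Cons y a)
  show ?case
  proof (cases l)
    case (Suc m)
    have "sum_list (take m a) \<le> sum_list (take m (y # a))" using Cons by simp
    moreover have "y \<le> x" using Cons.prems by simp
    ultimately show ?thesis using Suc by simp
  qed simp
qed simp

text \<open>\<open>Cs\<close> lists the neighbourhoods of the vertices on the \<open>a\<close> side.
  The other side is a function on an index set rather than a sorted list, so residual degrees need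
  no reordering; \<open>b\<close> and \<open>t\<close> vary in the induction.\<close>

lemma greedy_rows:
  fixes a :: "nat list" and b :: "'j \<Rightarrow> nat"
  assumes "finite J" "sorted_wrt (\<ge>) a"
    and "\<And>l. l \<le> length a \<Longrightarrow> sum_list (take l a) \<le> (\<Sum>j\<in>J. min l (b j)) + t"
  shows "\<exists>Cs. list_all2 (\<lambda>C x. C \<subseteq> J \<and> card C \<le> x) Cs a \<and>
    (\<forall>j\<in>J. length (filter ((\<in>) j) Cs) \<le> b j) \<and> sum_list a \<le> sum_list (map card Cs) + t"
  using assms(2,3)
proof (induction a arbitrary: b t)
  case (Cons x a)
  let ?J = "{j \<in> J. 0 < b j}"
  let ?k = "min x (card ?J)"
  obtain C where C: "C \<subseteq> ?J" "card C = ?k" "\<forall>i\<in>C. \<forall>j\<in>?J - C. b j \<le> b i"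
    using ex_subset_of_largest[of ?J ?k b] assms(1) by auto
  have CJ: "C \<subseteq> J" using C by auto
  define b' where "b' j = b j - of_bool (j \<in> C)" for j
  \<comment> \<open>The allowance left after charging the shortfall of the first row. The inequality
    for \<open>l = 1\<close> shows that the shortfall is at most \<open>t\<close>, so the
    subtraction does not truncate.\<close>
  define t' where "t' = t - (x - ?k)"
  have "x \<le> card ?J + t"
  proof -
    have "(\<Sum>j\<in>J. min 1 (b j)) = (\<Sum>j\<in>J. of_bool (0 < b j))" by (rule sum.cong) auto
    also have "\<dots> = card ?J" using assms(1) by (simp add: Int_def)
    finally show ?thesis using Cons.prems(2)[of 1] by simp
  qed
  then have t: "t = t' + (x - ?k)" unfolding t'_def by linarith
  have split: "(\<Sum>j\<in>J. f j) = (\<Sum>j\<in>C. f j) + (\<Sum>j\<in>J - C. f j)" for f :: "'j \<Rightarrow> nat"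
    using sum.subset_diff[OF CJ assms(1)] by (simp add: add.commute)
  have "sum_list (take l a) \<le> (\<Sum>j\<in>J. min l (b' j)) + t'" if l: "l \<le> length a" for l
  proof (cases "\<exists>j\<in>J - C. l < b j")
    case False
    \<comment> \<open>Every column longer than \<open>l\<close> was used, so the sum of the \<open>min\<close>s drops by exactly \<open>card C\<close>.\<close>
    have "(\<Sum>j\<in>C. min (Suc l) (b j)) = (\<Sum>j\<in>C. min l (b' j) + 1)"
      using C by (intro sum.cong) (auto simp: b'_def min_def)
    also have "\<dots> = (\<Sum>j\<in>C. min l (b' j)) + ?k" using C by (simp only: sum.distrib) simp
    finally have "(\<Sum>j\<in>C. min (Suc l) (b j)) = (\<Sum>j\<in>C. min l (b' j)) + ?k" .
    moreover have "(\<Sum>j\<in>J - C. min (Suc l) (b j)) = (\<Sum>j\<in>J - C. min l (b' j))"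
    proof (intro sum.cong refl)
      fix j assume "j \<in> J - C"
      then have "b j \<le> l" "j \<notin> C" using False by force+
      then show "min (Suc l) (b j) = min l (b' j)" by (simp add: b'_def)
    qed
    ultimately have "(\<Sum>j\<in>J. min (Suc l) (b j)) = (\<Sum>j\<in>J. min l (b' j)) + ?k"
      unfolding split by simp
    moreover have "x + sum_list (take l a) \<le> (\<Sum>j\<in>J. min (Suc l) (b j)) + t"
      using Cons.prems(2)[of "Suc l"] l by simp
    ultimately show ?thesis using t by linarith
  next
    case True
    \<comment> \<open>Every column used is longer than \<open>l\<close>, so no \<open>min\<close> drops.\<close>
    then obtain j where j: "j \<in> J - C" "l < b j" by blast
    then have jC: "j \<in> ?J - C" by auto
    \<comment> \<open>The column \<open>j\<close> was available but not chosen, so every chosen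
      column is at least as long as it.\<close>
    have long: "l < b i" if "i \<in> C" for i
      using C(3) that jC j(2) by (meson less_le_trans)
    \<comment> \<open>An available column is left over, so the first row was filled completely and
      nothing is charged.\<close>
    have "C \<subset> ?J" using C(1) jC by blast
    then have "card C < card ?J" using assms(1) by (intro psubset_card_mono) auto
    then have "t' = t" using C(2) t by linarith
    moreover have "(\<Sum>j\<in>J. min l (b' j)) = (\<Sum>j\<in>J. min l (b j))"
      using long by (intro sum.cong) (auto simp: b'_def min_def dest: long)
    moreover have "sum_list (take l a) \<le> sum_list (take l (x # a))"
      by (rule sum_list_take_le_take_Cons[OF Cons.prems(1)])
    ultimately show ?thesis using Cons.prems(2)[of l] l by fastforce
  qed
  then obtain Cs where Cs: "list_all2 (\<lambda>C x. C \<subseteq> J \<and> card C \<le> x) Cs a"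
      "\<forall>j\<in>J. length (filter ((\<in>) j) Cs) \<le> b' j" "sum_list a \<le> sum_list (map card Cs) + t'"
    using Cons.IH[of b' t'] Cons.prems(1) by auto
  show ?case
  proof (intro exI[of _ "C # Cs"] conjI ballI)
    show "list_all2 (\<lambda>C x. C \<subseteq> J \<and> card C \<le> x) (C # Cs) (x # a)" using Cs CJ C by simp
    show "sum_list (x # a) \<le> sum_list (map card (C # Cs)) + t" using Cs(3) C(2) t by simp
    fix j assume "j \<in> J"
    then show "length (filter ((\<in>) j) (C # Cs)) \<le> b j"
      using Cs(2) C(1) by (fastforce simp: b'_def)
  qed
qed (intro exI[of _ "[]"], simp)

section \<open>Pairing the remaining stubs\<close>

lemma ex_mset_pairs:
  assumes "size X = size Y"
  shows "\<exists>M. image_mset fst M = X \<and> image_mset snd M = Y"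
proof -
  obtain xs ys where "mset xs = X" "mset ys = Y" by (metis ex_mset)
  then have "length xs = length ys" using assms by auto
  then have "map fst (zip xs ys) = xs" "map snd (zip xs ys) = ys" by auto
  then show ?thesis using \<open>mset xs = X\<close> \<open>mset ys = Y\<close>
    by (intro exI[of _ "mset (zip xs ys)"]) (simp flip: mset_map)
qed

text \<open>Half-edges, each named by its vertex. A multiset of pairs projecting to
  \<open>stubs a\<close> and \<open>stubs b\<close> is thus a bipartite multigraph with these
  degrees.\<close>

definition stubs :: "nat list \<Rightarrow> nat multiset" where
  "stubs a = (\<Sum>i<length a. replicate_mset (a ! i) i)"

lemma count_stubs: "count (stubs a) i = (if i < length a then a ! i else 0)"
  by (simp add: stubs_def count_sum)

lemma size_stubs: "size (stubs a) = sum_list a"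
  by (simp add: stubs_def size_multiset_sum sum_list_sum_nth atLeast0LessThan)

lemma ex_bipartite_pairs:
  assumes "sorted_wrt (\<ge>) a" "sum_list a = sum_list b"
    and "\<And>l. l \<le> length a \<Longrightarrow> sum_list (take l a) \<le> sum_list (map (min l) b) + t"
  obtains M where "image_mset fst M = stubs a" "image_mset snd M = stubs b"
    "size M \<le> card (set_mset M) + t"
proof -
  have "\<exists>Cs. list_all2 (\<lambda>C x. C \<subseteq> {..<length b} \<and> card C \<le> x) Cs a \<and>
    (\<forall>j\<in>{..<length b}. length (filter ((\<in>) j) Cs) \<le> b ! j) \<and>
    sum_list a \<le> sum_list (map card Cs) + t"
    using assms(1,3) by (intro greedy_rows) (simp_all add: sum_min_eq_sum_list)
  then obtain Cs where Cs: "list_all2 (\<lambda>C x. C \<subseteq> {..<length b} \<and> card C \<le> x) Cs a"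
    "\<And>j. j < length b \<Longrightarrow> length (filter ((\<in>) j) Cs) \<le> b ! j"
    "sum_list a \<le> sum_list (map card Cs) + t"
    by auto
  define E where "E = Sigma {..<length Cs} ((!) Cs)"
  have len: "length Cs = length a" and sub: "\<And>i. i < length a \<Longrightarrow> Cs ! i \<subseteq> {..<length b}"
    and card: "\<And>i. i < length a \<Longrightarrow> card (Cs ! i) \<le> a ! i"
    using Cs(1) by (auto simp: list_all2_conv_all_nth)
  have finC: "finite (Cs ! i)" if "i < length a" for i
    using sub[OF that] finite_subset by blast
  then have finE: "finite E" by (auto simp: E_def len)
  have cardE: "card E = sum_list (map card Cs)"
    using finC by (simp add: E_def len sum_list_sum_nth atLeast0LessThan)
  have cnt: "count (image_mset f (mset_set E)) y = card {e \<in> E. f e = y}" for f :: "nat \<times> nat \<Rightarrow> nat" and y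
    using finE by (simp add: count_image_mset' Int_def vimage_def conj_commute eq_commute[of y])
  have fst: "image_mset fst (mset_set E) \<subseteq># stubs a"
  proof (rule mset_subset_eqI)
    fix i
    have "{e \<in> E. fst e = i} = (if i < length a then Pair i ` (Cs ! i) else {})"
      by (auto simp: E_def len)
    then show "count (image_mset fst (mset_set E)) i \<le> count (stubs a) i"
      using card by (simp add: cnt count_stubs card_image inj_on_def)
  qed
  have snd: "image_mset snd (mset_set E) \<subseteq># stubs b"
  proof (rule mset_subset_eqI)
    fix j
    have eq: "{e \<in> E. snd e = j} = (\<lambda>i. (i, j)) ` {i. i < length Cs \<and> j \<in> Cs ! i}"
      by (auto simp: E_def)
    have "card {e \<in> E. snd e = j} = length (filter ((\<in>) j) Cs)"
      unfolding eq by (subst card_image) (auto simp: inj_on_def length_filter_conv_card)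
    then have "card {e \<in> E. snd e = j} \<le> b ! j" if "j < length b"
      using Cs(2)[OF that] by simp
    moreover have "card {e \<in> E. snd e = j} \<le> 0" if "\<not> j < length b"
    proof -
      have "{e \<in> E. snd e = j} = {}" using that sub by (auto simp: E_def len)
      then show ?thesis by (simp only: card.empty)
    qed
    ultimately show "count (image_mset snd (mset_set E)) j \<le> count (stubs b) j"
      unfolding cnt count_stubs by (simp only: split: if_split) blast
  qed
  \<comment> \<open>Both sides have equally many stubs, and each pair in \<open>E\<close> uses one
    on either side.\<close>
  have "size (stubs a - image_mset fst (mset_set E)) = size (stubs b - image_mset snd (mset_set E))"
    using fst snd assms(2) by (simp add: size_Diff_submset size_stubs)
  then obtain R where R: "image_mset fst R = stubs a - image_mset fst (mset_set E)"
    "image_mset snd R = stubs b - image_mset snd (mset_set E)"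
    using ex_mset_pairs by blast
  show ?thesis
  proof
    let ?M = "mset_set E + R"
    show M: "image_mset fst ?M = stubs a" using R fst by simp
    show "image_mset snd ?M = stubs b" using R snd by simp
    \<comment> \<open>\<open>R\<close> may repeat pairs of \<open>E\<close>; even if none of its
      pairs is new, the excess is only the at most \<open>t\<close> pairs of
      \<open>R\<close>.\<close>
    have "card E \<le> card (set_mset ?M)" using finE by (intro card_mono) auto
    moreover have "size ?M = sum_list a" using arg_cong[OF M, of size] by (simp add: size_stubs)
    ultimately show "size ?M \<le> card (set_mset ?M) + t" using Cs(3) cardE by linarith
  qed
qed

section \<open>Realisation as a multigraph on natural numbers\<close>

lemma degree_sequence_of_atLeastLessThan:
  assumes "sorted_wrt (\<ge>) a" "\<And>i. i < length a \<Longrightarrow> degree H (k + i) = a ! i"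
  shows "degree_sequence_of H {k..<k + length a} = a"
proof -
  have "map (degree H) [k..<k + length a] = a"
    using assms(2) by (intro nth_equalityI) auto
  then have "image_mset (degree H) (mset_set {k..<k + length a}) = mset a"
    by (metis mset_map mset_upt)
  also have "\<dots> = mset (rev a)" by simp
  finally have "sorted_list_of_multiset (image_mset (degree H) (mset_set {k..<k + length a})) = rev a"
    using assms(1) by (simp only: sorted_list_of_multiset_mset) (simp add: sorted_sort_id sorted_wrt_rev)
  then show ?thesis by (simp add: degree_sequence_of_def)
qed

lemma sum_le_imp_tot_bigraphic:
  assumes "sorted_wrt (\<ge>) a" "sorted_wrt (\<ge>) b" "sum_list a = sum_list b"
    and "\<And>l. l \<le> length a \<Longrightarrow> sum_list (take l a) \<le> sum_list (map (min l) b) + t"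
  shows "tot_bigraphic t a b"
proof -
  obtain M where M: "image_mset fst M = stubs a" "image_mset snd M = stubs b"
    "size M \<le> card (set_mset M) + t"
    using ex_bipartite_pairs assms by metis
  let ?p = "length a" and ?q = "length b"
  \<comment> \<open>Shifting the second side by \<open>?p\<close> makes the two sides disjoint
    intervals.\<close>
  define edge where "edge = (\<lambda>(i, j). {i, ?p + j})"
  define H where "H = \<lparr>verts = {0..<?p + ?q}, edges = image_mset edge M\<rparr>"
  have bounds: "fst e < ?p" "snd e < ?q" if "e \<in># M" for e
  proof -
    have "fst e \<in># stubs a" "snd e \<in># stubs b" using that by (auto simp flip: M)
    then show "fst e < ?p" "snd e < ?q"
      by (auto simp: count_stubs simp flip: count_greater_zero_iff split: if_splits)
  qed
  \<comment> \<open>The ends below and above \<open>?p\<close> recover the pair from the unordered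
    edge, so passing to sets creates no new parallel edges.\<close>
  have "inj_on edge (set_mset M)"
    using bounds by (fastforce simp: inj_on_def edge_def doubleton_eq_iff)
  then have "card (underlying_edges H) = card (set_mset M)"
    by (simp add: underlying_edges_def H_def card_image)
  then have tot: "TotMult H \<le> t" using M(3) by (simp add: TotMult_def H_def)
  have degA: "degree H (0 + i) = a ! i" if "i < ?p" for i
  proof -
    have "degree H i = size {#e \<in># M. i \<in> edge e#}"
      by (simp add: degree_def H_def filter_mset_image_mset)
    also have "{#e \<in># M. i \<in> edge e#} = {#e \<in># M. fst e = i#}"
      using that by (intro filter_mset_cong) (auto simp: edge_def)
    also have "size \<dots> = count (image_mset fst M) i"
      by (simp add: count_conv_size_mset filter_mset_image_mset)
    finally show ?thesis using that M(1) by (simp add: count_stubs)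
  qed
  have degB: "degree H (?p + j) = b ! j" if "j < ?q" for j
  proof -
    have "degree H (?p + j) = size {#e \<in># M. ?p + j \<in> edge e#}"
      by (simp add: degree_def H_def filter_mset_image_mset)
    also have "{#e \<in># M. ?p + j \<in> edge e#} = {#e \<in># M. snd e = j#}"
      using bounds by (intro filter_mset_cong) (fastforce simp: edge_def)+
    also have "size \<dots> = count (image_mset snd M) j"
      by (simp add: count_conv_size_mset filter_mset_image_mset)
    finally show ?thesis using that M(2) by (simp add: count_stubs)
  qed
  have "\<exists>u\<in>{0..<0 + ?p}. \<exists>v\<in>{?p..<?p + ?q}. edge e = {u, v}" if "e \<in># M" for e
    using bounds[OF that]
    by (intro bexI[of _ "fst e"] bexI[of _ "?p + snd e"]) (auto simp: edge_def case_prod_unfold)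
  then have "underlying_bipartite H {0..<0 + ?p} {?p..<?p + ?q}"
    by (auto simp: underlying_bipartite_def underlying_edges_def H_def)
  moreover have "loopless_multigraph H"
    using bounds by (fastforce simp: loopless_multigraph_def H_def edge_def card_insert_if)
  ultimately show ?thesis
    using tot degree_sequence_of_atLeastLessThan[OF assms(1) degA]
      degree_sequence_of_atLeastLessThan[OF assms(2) degB]
    unfolding tot_bigraphic_def by blast
qed

theorem theorem11:
  fixes d a b :: "nat list" and t :: nat
  assumes "degree_sequence d" and "(a, b) \<in> BP d" and "0 < t"
  shows "tot_bigraphic t a b \<longleftrightarrow>
    (\<forall>l\<in>{1..length a}. (\<Sum>i<l. a ! i) \<le> (\<Sum>i<length b. min l (b ! i)) + t)"
proof
  assume "tot_bigraphic t a b"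
  then show "\<forall>l\<in>{1..length a}. (\<Sum>i<l. a ! i) \<le> (\<Sum>i<length b. min l (b ! i)) + t"
    using tot_bigraphic_imp_sum_le by (simp add: sum_min_eq_sum_list sum_nth_eq_sum_list_take)
next
  assume *: "\<forall>l\<in>{1..length a}. (\<Sum>i<l. a ! i) \<le> (\<Sum>i<length b. min l (b ! i)) + t"
  have "sum_list (take l a) \<le> sum_list (map (min l) b) + t" if "l \<le> length a" for l
    \<comment> \<open>The case \<open>l = 0\<close>, absent from the hypothesis, is an empty
      sum.\<close>
    using * that by (cases "l = 0") (auto simp: sum_min_eq_sum_list sum_nth_eq_sum_list_take)
  moreover have "sum_list a = sum_list b" using assms(2) by (auto simp: BP_def)
  ultimately show "tot_bigraphic t a b"
    using sum_le_imp_tot_bigraphic BP_non_increasing[OF assms(1,2)] by blast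
qed

end
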